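(* Let $n,k$ be positive integers and let $\mathcal{E}=\lambda/\mu$ be a skew diagram (with $\mu\subset\lambda$ partitions). If $\mathcal{D}(\mathcal{E})\neq\varnothing$ and $|\mathcal{E}|=kn$, then $\mathcal{E}$ is a horizontal $n$-border strip of weight $k$ if and only if $m(\mathcal{E})=k$.
   Context: Young diagrams are drawn with rows numbered from top to bottom and columns from left to right; $|\mathcal{E}|$ is the number of boxes of $\mathcal{E}$. A skew diagram is an $r$-border strip if it consists of $r$ boxes, is connected and contains no $2\times 2$ square; its starting box is its northeasternmost box. $(\lambda/\mu)\!\uparrow$ is the set consisting of the top box of each (nonempty) column of $\lambda/\mu$. An $n$-border strip chain (decomposition) of $\lambda/\mu$ of weight $\tau=(\tau_1,\ldots,\tau_l)$, with all $\tau_i\ge1$ integers, is a chain of partitions $\underline{\alpha}:\mu=\alpha^{(0)}\subset\alpha^{(1)}\subset\cdots\subset\alpha^{(l)}=\lambda$ such that each $\alpha^{(i)}/\alpha^{(i-1)}$ is a $\tau_i n$-border strip; its length is $l(\underline{\alpha})=l$. The chain is called horizontal if the starting box of each $\alpha^{(i)}/\alpha^{(i-1)}$ lies in $(\lambda/\mu)\!\uparrow$ and, whenever $i<j$, the starting box of $\alpha^{(i)}/\alpha^{(i-1)}$ lies southwest (weakly below and strictly to the left) of that of $\alpha^{(j)}/\alpha^{(j-1)}$. $\mathcal{D}(\mathcal{E})$ is the set of all $n$-border strip chains of $\mathcal{E}$ (of arbitrary weight $\tau$), $\mathcal{H}(\mathcal{E})\subset\mathcal{D}(\mathcal{E})$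 is the subset of horizontal ones, and $m(\mathcal{E})=\max\{l(\underline{\alpha}) : \underline{\alpha}\in\mathcal{H}(\mathcal{E})\}$. $\mathcal{E}$ is a horizontal $n$-border strip of weight $k$ if it has a horizontal $n$-border strip chain of length $k$ with $\tau_i=1$ for all $i$. *)

theory Defs
  imports Main
begin

text \<open>Partitions are weakly decreasing sequences with finitely many nonzero parts, indexed
  from 0; inclusion of Young diagrams is then the pointwise order on functions.\<close>

definition is_partition :: "(nat \<Rightarrow> nat) \<Rightarrow> bool" where
  "is_partition p \<longleftrightarrow> antimono p \<and> finite {i. p i \<noteq> 0}"

text \<open>A box is a pair (row, column); rows are numbered from top to bottom and columns from left
  to right, both starting at 0.\<close>

type_synonym box = "nat \<times> nat"

definition diagram :: "(nat \<Rightarrow> nat) \<Rightarrow> box set" where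
  "diagram p = {(i, j). j < p i}"

definition skew :: "(nat \<Rightarrow> nat) \<Rightarrow> (nat \<Rightarrow> nat) \<Rightarrow> box set" where
  "skew p q = diagram p - diagram q"

definition adjacent :: "box \<Rightarrow> box \<Rightarrow> bool" where
  "adjacent b c \<longleftrightarrow>
     fst b = fst c \<and> (snd b = Suc (snd c) \<or> snd c = Suc (snd b)) \<or>
     snd b = snd c \<and> (fst b = Suc (fst c) \<or> fst c = Suc (fst b))"

definition connected_boxes :: "box set \<Rightarrow> bool" where
  "connected_boxes S \<longleftrightarrow>
     (\<forall>b\<in>S. \<forall>c\<in>S. (b, c) \<in> {(x, y). x \<in> S \<and> y \<in> S \<and> adjacent x y}\<^sup>*)"

text \<open>Only applied to skew diagrams.\<close>

definition border_strip :: "nat \<Rightarrow> box set \<Rightarrow> bool" where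
  "border_strip r S \<longleftrightarrow> finite S \<and> card S = r \<and> connected_boxes S \<and>
     \<not> (\<exists>i j. {(i, j), (i, Suc j), (Suc i, j), (Suc i, Suc j)} \<subseteq> S)"

text \<open>The northeasternmost box; it exists and is unique if \<open>S\<close> is a nonempty border strip.\<close>

definition starting_box :: "box set \<Rightarrow> box" where
  "starting_box S = (THE b. b \<in> S \<and> (\<forall>c\<in>S. fst b \<le> fst c \<and> snd c \<le> snd b))"

definition column_tops :: "box set \<Rightarrow> box set" where
  "column_tops S = {(i, j) \<in> S. \<forall>i'. (i', j) \<in> S \<longrightarrow> i \<le> i'}"

definition southwest :: "box \<Rightarrow> box \<Rightarrow> bool" where
  "southwest b c \<longleftrightarrow> fst c \<le> fst b \<and> snd b < snd c"

text \<open>A chain of length \<open>l\<close> is the list of its \<open>l + 1\<close> partitions, from \<open>mu\<close> up to \<open>lam\<close>; the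
  entry \<open>\<tau> ! i\<close> of the weight belongs to the step from \<open>\<alpha> ! i\<close> to \<open>\<alpha> ! Suc i\<close>. In all
  constants below, the arguments \<open>lam\<close>, \<open>mu\<close> come in this order, as in \<open>\<lambda>/\<mu>\<close>.\<close>

definition strip_chain ::
  "nat \<Rightarrow> nat list \<Rightarrow> (nat \<Rightarrow> nat) \<Rightarrow> (nat \<Rightarrow> nat) \<Rightarrow> (nat \<Rightarrow> nat) list \<Rightarrow> bool" where
  "strip_chain n \<tau> lam mu \<alpha> \<longleftrightarrow>
     length \<alpha> = Suc (length \<tau>) \<and> \<alpha> ! 0 = mu \<and> \<alpha> ! length \<tau> = lam \<and>
     (\<forall>i \<le> length \<tau>. is_partition (\<alpha> ! i)) \<and>
     (\<forall>i < length \<tau>. \<tau> ! i \<ge> 1 \<and> \<alpha> ! i \<le> \<alpha> ! Suc i \<and>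
        border_strip (\<tau> ! i * n) (skew (\<alpha> ! Suc i) (\<alpha> ! i)))"

definition chain_length :: "(nat \<Rightarrow> nat) list \<Rightarrow> nat" where
  "chain_length \<alpha> = length \<alpha> - 1"

definition chain_start :: "(nat \<Rightarrow> nat) list \<Rightarrow> nat \<Rightarrow> box" where
  "chain_start \<alpha> i = starting_box (skew (\<alpha> ! Suc i) (\<alpha> ! i))"

definition horizontal_chain ::
  "(nat \<Rightarrow> nat) \<Rightarrow> (nat \<Rightarrow> nat) \<Rightarrow> (nat \<Rightarrow> nat) list \<Rightarrow> bool" where
  "horizontal_chain lam mu \<alpha> \<longleftrightarrow>
     (\<forall>i < chain_length \<alpha>. chain_start \<alpha> i \<in> column_tops (skew lam mu)) \<and>
     (\<forall>i j. i < j \<and> j < chain_length \<alpha> \<longrightarrow> southwest (chain_start \<alpha> i) (chain_start \<alpha> j))"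

definition strip_chains ::
  "nat \<Rightarrow> (nat \<Rightarrow> nat) \<Rightarrow> (nat \<Rightarrow> nat) \<Rightarrow> (nat \<Rightarrow> nat) list set" where
  "strip_chains n lam mu = {\<alpha>. \<exists>\<tau>. strip_chain n \<tau> lam mu \<alpha>}"

definition horizontal_strip_chains ::
  "nat \<Rightarrow> (nat \<Rightarrow> nat) \<Rightarrow> (nat \<Rightarrow> nat) \<Rightarrow> (nat \<Rightarrow> nat) list set" where
  "horizontal_strip_chains n lam mu = {\<alpha> \<in> strip_chains n lam mu. horizontal_chain lam mu \<alpha>}"

text \<open>The set of lengths is finite for \<open>n \<ge> 1\<close>, and it is nonempty whenever \<open>strip_chains n lam mu\<close>
  is, so this maximum exists in that case; otherwise the value is unspecified.\<close>

definition max_horizontal_length :: "nat \<Rightarrow> (nat \<Rightarrow> nat) \<Rightarrow> (nat \<Rightarrow> nat) \<Rightarrow> nat" where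
  "max_horizontal_length n lam mu = Max (chain_length ` horizontal_strip_chains n lam mu)"

definition horizontal_border_strip ::
  "nat \<Rightarrow> nat \<Rightarrow> (nat \<Rightarrow> nat) \<Rightarrow> (nat \<Rightarrow> nat) \<Rightarrow> bool" where
  "horizontal_border_strip n k lam mu \<longleftrightarrow>
     (\<exists>\<alpha>. strip_chain n (replicate k 1) lam mu \<alpha> \<and> horizontal_chain lam mu \<alpha>)"

end

theory Submission
  imports Defs
begin

text \<open>A horizontal chain of length \<open>k\<close> and total size \<open>k n\<close> has all weights 1, so the point is that
  horizontal chains exist at all. Encode a partition \<open>p\<close> by its set of beads \<open>p i - i\<close>. Adding a
  border strip of size \<open>r\<close> moves one bead \<open>r\<close> places to the right, onto a free place, and the chain
  is horizontal if beads land further and further to the right. Any sequence of moves can be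
  sorted in this way: a move \<open>z \<rightarrow> w\<close> coming after \<open>y \<rightarrow> p\<close> with \<open>w < p\<close> is either exchanged with it
  or, if \<open>w = y\<close>, merged with it into \<open>z \<rightarrow> p\<close>.\<close>

section \<open>Moving beads\<close>

text \<open>The distance may be any positive multiple of \<open>n\<close>, since strips of arbitrary
  weight are allowed and merging two moves adds their distances.\<close>

definition bead_move :: "nat \<Rightarrow> int set \<Rightarrow> int set \<Rightarrow> int \<Rightarrow> int \<Rightarrow> bool" where
  "bead_move n S T y p \<longleftrightarrow>
     y \<in> S \<and> p \<notin> S \<and> y < p \<and> int n dvd p - y \<and> T = insert p (S - {y})"

text \<open>The side condition says that every bead right of the newest landing place was there from
  the start; this forces the landing places to increase. Stated through \<open>S\<close>, it will
  say that the rows above the new strip are still those of the initial partition.\<close>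

inductive sorted_moves :: "nat \<Rightarrow> int set \<Rightarrow> int set \<Rightarrow> bool" for n S where
  refl: "sorted_moves n S S"
| step: "sorted_moves n S T \<Longrightarrow> bead_move n T U y p \<Longrightarrow> U \<inter> {p<..} \<subseteq> S \<Longrightarrow> sorted_moves n S U"

text \<open>Insertion sort: the appended move is compared with the last sorted one and passed down
  while it lands further left. Hence the induction with arbitrary \<open>T\<close>, \<open>z\<close>
  and \<open>w\<close>.\<close>

lemma sorted_moves_move:
  assumes "sorted_moves n S K" and "bead_move n K T z w"
  shows "sorted_moves n S T"
  using assms
proof (induction arbitrary: T z w rule: sorted_moves.induct)
  case refl
  have "T \<inter> {w<..} \<subseteq> S" using refl by (auto simp: bead_move_def)
  then show ?case using refl sorted_moves.refl sorted_moves.step by blast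
next
  case (step K' K y p)
  have "w \<noteq> p" using step.hyps(2) step.prems by (auto simp: bead_move_def)
  then consider "w > p" | "w < p" "w = y" | "w < p" "w \<noteq> y" by linarith
  then show ?case
  proof cases
    case 1
    then have "T \<inter> {w<..} \<subseteq> S" using step.hyps(3) step.prems by (auto simp: bead_move_def)
    moreover have "sorted_moves n S K" using step.hyps sorted_moves.step by blast
    ultimately show ?thesis using step.prems sorted_moves.step by blast
  next
    case 2
    \<comment> \<open>The place \<open>y\<close> vacated by the last move is refilled from
      \<open>z\<close>, so the net effect is one move from \<open>z\<close> to \<open>p\<close>,
      whose length is the sum of the two.\<close>
    have dvd: "int n dvd p - z"
    proof -
      have "p - z = (p - y) + (w - z)" using 2 by simp
      then show ?thesis using step.hyps(2) step.prems by (auto simp only: bead_move_def dvd_add)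
    qed
    have "bead_move n K' T z p"
      using 2 dvd step.hyps(2) step.prems by (auto simp: bead_move_def)
    moreover have "T \<inter> {p<..} \<subseteq> S"
      using 2 step.hyps(3) step.prems by (auto simp: bead_move_def)
    ultimately show ?thesis using step.hyps(1) sorted_moves.step by blast
  next
    case 3
    \<comment> \<open>The two moves commute. The bead \<open>z\<close> is already in
      \<open>K'\<close> because \<open>z < w < p\<close> excludes \<open>z = p\<close>, it differs
      from \<open>y\<close> because \<open>y\<close> was vacated, and \<open>w \<noteq> y\<close>
      makes \<open>w\<close> free in \<open>K'\<close>. Beads right of \<open>p\<close> are
      unaffected.\<close>
    define T' where "T' = insert w (K' - {z})"
    have "bead_move n K' T' z w"
      using 3 step.hyps(2) step.prems by (auto simp: bead_move_def T'_def)
    then have "sorted_moves n S T'" by (rule step.IH)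
    moreover have "bead_move n T' T y p"
      using 3 step.hyps(2) step.prems by (auto simp: bead_move_def T'_def)
    moreover have "T \<inter> {p<..} \<subseteq> S"
      using 3 step.hyps(3) step.prems by (auto simp: bead_move_def)
    ultimately show ?thesis by (rule sorted_moves.step)
  qed
qed

section \<open>Beads of a partition\<close>

text \<open>Up to a shift, these are the beta-numbers of the partition; subtracting the row index
  makes the sequence strictly decreasing.\<close>

definition bead :: "(nat \<Rightarrow> nat) \<Rightarrow> nat \<Rightarrow> int" where
  "bead p i = int (p i) - int i"

text \<open>The cutoff \<open>N\<close> will lie beyond all nonzero rows of \<open>lam\<close>,
  hence of every partition in the chain. Empty rows before \<open>N\<close> still carry
  beads.\<close>

definition beads :: "nat \<Rightarrow> (nat \<Rightarrow> nat) \<Rightarrow> int set" where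
  "beads N p = bead p ` {..<N}"

lemma partition_le: "is_partition p \<Longrightarrow> i \<le> j \<Longrightarrow> p j \<le> p i"
  by (auto simp: is_partition_def antimono_def)

lemma bead_less_iff:
  assumes "is_partition p"
  shows "bead p j < bead p i \<longleftrightarrow> i < j"
proof -
  have "i < j \<Longrightarrow> bead p j < bead p i" for i j
    using partition_le[OF assms, of i j] by (simp add: bead_def)
  then show ?thesis by (metis less_asym linorder_less_linear)
qed

lemma bead_eq_iff:
  assumes "is_partition p"
  shows "bead p j = bead p i \<longleftrightarrow> i = j"
  by (metis assms bead_less_iff less_irrefl linorder_less_linear)

text \<open>Turns the side condition of \<open>sorted_moves\<close> into a statement on rows: with
  \<open>q \<le> p\<close>, the rows above \<open>a\<close> agree. If
  \<open>bead p i = bead q j\<close> with \<open>j < i\<close>, induction would give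
  \<open>bead p j \<le> bead q j = bead p i\<close>, against strict decrease; so
  \<open>i \<le> j\<close>.\<close>

lemma bead_le_of_beads_above:
  assumes p: "is_partition p" and q: "is_partition q" and "q \<le> p"
    and sub: "beads N p \<inter> {bead p a<..} \<subseteq> beads N q"
    and "a \<le> N" "i < a"
  shows "bead p i \<le> bead q i"
  using \<open>i < a\<close>
proof (induction i rule: less_induct)
  case (less i)
  then have "bead p i \<in> beads N p \<inter> {bead p a<..}"
    using \<open>a \<le> N\<close> bead_less_iff[OF p] by (auto simp: beads_def)
  then obtain j where j: "bead p i = bead q j" using sub by (auto simp: beads_def)
  have "i \<le> j"
  proof (rule ccontr)
    assume "\<not> i \<le> j"
    then have "bead p j \<le> bead q j" and "bead p i < bead p j"
      using less bead_less_iff[OF p] by auto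
    then show False using j by simp
  qed
  then show ?case using j bead_less_iff[OF q] by (metis not_less)
qed

text \<open>A strictly decreasing sequence is determined by its set of values.\<close>

lemma beads_inject:
  assumes p: "is_partition p" and q: "is_partition q"
    and "\<And>i. i \<ge> N \<Longrightarrow> p i = 0" "\<And>i. i \<ge> N \<Longrightarrow> q i = 0"
    and eq: "beads N p = beads N q"
  shows "p = q"
proof
  fix i
  show "p i = q i"
  proof (induction i rule: less_induct)
    case (less i)
    show ?case
    proof (cases "i < N")
      case True
      have le: "bead r i \<le> bead s i"
        if r: "is_partition r" and s: "is_partition s" and rs: "beads N r = beads N s"
          and IH: "\<And>j. j < i \<Longrightarrow> r j = s j" for r s
      proof -
        obtain j where j: "bead r i = bead s j" using rs True by (auto simp: beads_def)
        have "\<not> j < i"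
          using j IH[of j] bead_eq_iff[OF r, of i j] by (auto simp: bead_def)
        then show ?thesis using j bead_less_iff[OF s] by (metis not_less)
      qed
      have "bead p i = bead q i"
        using le[OF p q eq] le[OF q p eq[symmetric]] less by (auto intro: antisym)
      then show ?thesis by (simp add: bead_def)
    qed (use assms in simp)
  qed
qed

section \<open>Border strips as bead moves\<close>

text \<open>Row description of a border strip occupying rows \<open>a\<close> to \<open>c\<close>:
  consecutive rows share exactly one column. The middle equation amounts to
  \<open>bead q (Suc i) = bead p i\<close>.\<close>

definition ribbon_rows :: "(nat \<Rightarrow> nat) \<Rightarrow> (nat \<Rightarrow> nat) \<Rightarrow> nat \<Rightarrow> nat \<Rightarrow> bool" where
  "ribbon_rows p q a c \<longleftrightarrow> a \<le> c \<and> (\<forall>i. i < a \<or> c < i \<longrightarrow> q i = p i) \<and>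
     (\<forall>i. a \<le> i \<and> i < c \<longrightarrow> q (Suc i) = Suc (p i)) \<and> p c < q c"

section \<open>Size and bead set of a ribbon\<close>

lemma skew_eq: "skew q p = {(i, j). p i \<le> j \<and> j < q i}"
  by (auto simp: skew_def diagram_def)

lemma finite_skew:
  assumes "is_partition q"
  shows "finite (skew q p)"
proof -
  have "skew q p \<subseteq> (SIGMA i:{i. q i \<noteq> 0}. {..<q i})" by (auto simp: skew_eq)
  moreover have "finite \<dots>" using assms by (auto simp: is_partition_def)
  ultimately show ?thesis by (rule finite_subset)
qed

lemma ribbon_rows_less:
  assumes "is_partition q" "ribbon_rows p q a c" "a \<le> i" "i \<le> c"
  shows "p i < q i"
proof (cases "i = c")
  case False
  then have "q (Suc i) = Suc (p i)" using assms by (auto simp: ribbon_rows_def)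
  then show ?thesis using partition_le[OF assms(1), of i "Suc i"] by simp
qed (use assms in \<open>simp add: ribbon_rows_def\<close>)

text \<open>Row \<open>i\<close> has \<open>bead q i - bead p i\<close> boxes, and the sum
  telescopes since \<open>bead q (Suc i) = bead p i\<close>.\<close>

lemma card_ribbon:
  assumes q: "is_partition q" and rib: "ribbon_rows p q a c"
  shows "int (card (skew q p)) = bead q a - bead p c"
proof -
  have "skew q p = (SIGMA i:{a..c}. {p i..<q i})"
    using rib by (force simp: skew_eq ribbon_rows_def not_less[symmetric])
  then have "int (card (skew q p)) = (\<Sum>i=a..c. int (q i - p i))" by simp
  also have "\<dots> = (\<Sum>i=a..c. int (q i) - int (p i))"
    using ribbon_rows_less[OF q rib] by (intro sum.cong) (auto intro: of_nat_diff less_imp_le)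
  also have "\<dots> = bead q a - bead p c"
  proof -
    have "(\<Sum>i=a..m. int (q i) - int (p i)) = bead q a - bead p m" if "a \<le> m" "m \<le> c" for m
      using that
    proof (induction rule: dec_induct)
      case (step m)
      then have "q (Suc m) = Suc (p m)" using rib by (auto simp: ribbon_rows_def)
      then show ?case using step by (simp add: bead_def)
    qed (simp add: bead_def)
    then show ?thesis using rib by (auto simp: ribbon_rows_def)
  qed
  finally show ?thesis .
qed

text \<open>Rows \<open>a\<close> to \<open>c - 1\<close> of \<open>p\<close> hand their beads down
  to the next row of \<open>q\<close>; only the bead of row \<open>c\<close> is lost and that of row
  \<open>a\<close> is new.\<close>

lemma beads_ribbon:
  assumes p: "is_partition p" and rib: "ribbon_rows p q a c" and "c < N"
  shows "beads N q = insert (bead q a) (beads N p - {bead p c})"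
proof (intro equalityI subsetI)
  fix b assume "b \<in> beads N q"
  then obtain i where i: "i < N" "b = bead q i" by (auto simp: beads_def)
  consider "i = a" | "i < a \<or> c < i" | "a < i" "i \<le> c" by linarith
  then show "b \<in> insert (bead q a) (beads N p - {bead p c})"
  proof cases
    case 2
    then have "b = bead p i" "i \<noteq> c" using i rib by (auto simp: ribbon_rows_def bead_def)
    then show ?thesis using i bead_eq_iff[OF p] by (auto simp: beads_def)
  next
    case 3
    then obtain m where m: "i = Suc m" by (cases i) auto
    then have "b = bead p m" "m \<noteq> c" using i 3 rib by (auto simp: ribbon_rows_def bead_def)
    then show ?thesis using m i bead_eq_iff[OF p] by (auto simp: beads_def)
  qed (use i in simp)
next
  fix b assume b: "b \<in> insert (bead q a) (beads N p - {bead p c})"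
  show "b \<in> beads N q"
  proof (cases "b = bead q a")
    case True
    then show ?thesis using rib \<open>c < N\<close> by (auto simp: beads_def ribbon_rows_def)
  next
    case False
    then obtain i where i: "i < N" "b = bead p i" "i \<noteq> c" using b by (auto simp: beads_def)
    show ?thesis
    proof (cases "a \<le> i \<and> i < c")
      case True
      then have "b = bead q (Suc i)" "Suc i < N"
        using i rib \<open>c < N\<close> by (auto simp: ribbon_rows_def bead_def)
      then show ?thesis by (auto simp: beads_def)
    next
      case False
      then have "b = bead q i" using i rib by (auto simp: ribbon_rows_def bead_def)
      then show ?thesis using i by (auto simp: beads_def)
    qed
  qed
qed

section \<open>From a border strip to a bead move\<close>

lemma connected_boxes_crossing:
  assumes "connected_boxes S" "b \<in> S" "c \<in> S" "P b" "\<not> P c"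
  obtains x y where "x \<in> S" "y \<in> S" "adjacent x y" "P x" "\<not> P y"
proof -
  have "(b, c) \<in> {(x, y). x \<in> S \<and> y \<in> S \<and> adjacent x y}\<^sup>*"
    using assms by (auto simp: connected_boxes_def)
  then have "P c \<or> (\<exists>x y. x \<in> S \<and> y \<in> S \<and> adjacent x y \<and> P x \<and> \<not> P y)"
    by (induction rule: rtrancl_induct) (use assms in auto)
  then show ?thesis using assms that by blast
qed

text \<open>Connectedness makes consecutive rows share at least one column, and the absence of a
  square makes them share at most one.\<close>

lemma border_strip_ribbon_rows:
  assumes p: "is_partition p" and q: "is_partition q" and "p \<le> q"
    and strip: "border_strip r (skew q p)" and "r \<ge> 1"
  obtains a c where "ribbon_rows p q a c"
proof -
  define S where "S = skew q p"
  define R where "R = {i. p i < q i}"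
  have R: "i \<in> R \<longleftrightarrow> (i, p i) \<in> S" for i by (simp add: R_def S_def skew_eq)
  have "R \<subseteq> {i. q i \<noteq> 0}" by (auto simp: R_def)
  then have fin: "finite R" using q by (auto simp: is_partition_def intro: finite_subset)
  have "S \<noteq> {}" using strip \<open>r \<ge> 1\<close> by (auto simp: border_strip_def S_def)
  then obtain i j where "(i, j) \<in> S" by auto
  then have "i \<in> R" by (simp add: S_def R_def skew_eq)
  then have ne: "R \<noteq> {}" by auto
  define a where "a = Min R"
  define c where "c = Max R"
  have a: "a \<in> R" and c: "c \<in> R" using fin ne by (auto simp: a_def c_def)
  have eq: "q i = p i" if "i < a \<or> c < i" for i
  proof -
    have "i \<notin> R" using that Min_le[OF fin, of i] Max_ge[OF fin, of i] by (auto simp: a_def c_def)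
    then show ?thesis using \<open>p \<le> q\<close> by (auto simp: R_def le_fun_def intro: antisym)
  qed
  have mid: "q (Suc i) = Suc (p i)" if i: "a \<le> i" "i < c" for i
  proof (rule antisym)
    \<comment> \<open>A path from row \<open>a\<close> to row \<open>c\<close> must step from row
      \<open>i\<close> to row \<open>Suc i\<close>, within a common column.\<close>
    have "connected_boxes S" using strip by (simp add: border_strip_def S_def)
    moreover have "(a, p a) \<in> S" "(c, p c) \<in> S" using a c by (auto simp: R)
    moreover have "fst (a, p a) \<le> i" "\<not> fst (c, p c) \<le> i" using i by auto
    ultimately obtain x y where
      xy: "x \<in> S" "y \<in> S" "adjacent x y" "fst x \<le> i" "\<not> fst y \<le> i"
      by (rule connected_boxes_crossing[where P = "\<lambda>b. fst b \<le> i"])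
    then have "fst x = i" "fst y = Suc i" "snd x = snd y" by (auto simp: adjacent_def)
    then show "Suc (p i) \<le> q (Suc i)" using xy by (auto simp: S_def skew_eq)
    show "q (Suc i) \<le> Suc (p i)"
    proof (rule ccontr)
      assume "\<not> ?thesis"
      then have "{(i, p i), (i, Suc (p i)), (Suc i, p i), (Suc i, Suc (p i))} \<subseteq> S"
        using partition_le[OF p, of i "Suc i"] partition_le[OF q, of i "Suc i"]
        by (auto simp: S_def skew_eq)
      then show False using strip by (auto simp: border_strip_def S_def)
    qed
  qed
  have "a \<le> c" using fin c by (simp add: a_def)
  then have "ribbon_rows p q a c" using eq mid c by (auto simp: ribbon_rows_def R_def)
  then show ?thesis by (rule that)
qed

lemma border_strip_bead_move:
  assumes p: "is_partition p" and q: "is_partition q" and "p \<le> q"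
    and strip: "border_strip (t * n) (skew q p)" and "t * n \<ge> 1"
    and N: "\<And>i. i \<ge> N \<Longrightarrow> q i = 0"
  obtains x w where "bead_move n (beads N p) (beads N q) x w"
proof -
  obtain a c where rib: "ribbon_rows p q a c"
    using border_strip_ribbon_rows[OF p q \<open>p \<le> q\<close> strip \<open>t * n \<ge> 1\<close>] .
  then have "c < N" using N by (metis not_less not_less_zero ribbon_rows_def)
  have "a \<le> c" using rib by (simp add: ribbon_rows_def)
  have size: "bead q a - bead p c = int t * int n"
    using card_ribbon[OF q rib] strip by (simp add: border_strip_def)
  \<comment> \<open>A bead of \<open>p\<close> at this place would belong to a row above
    \<open>a\<close>; that row is unchanged in \<open>q\<close>, so \<open>q\<close> would have two
    equal beads.\<close>
  have "bead q a \<notin> beads N p"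
  proof
    assume "bead q a \<in> beads N p"
    then obtain i where i: "bead q a = bead p i" by (auto simp: beads_def)
    have "bead p a < bead q a"
      using ribbon_rows_less[OF q rib order_refl \<open>a \<le> c\<close>] by (simp add: bead_def)
    then have "i < a" using i bead_less_iff[OF p] by simp
    then have "bead q i = bead p i" using rib by (simp add: ribbon_rows_def bead_def)
    then show False using i \<open>i < a\<close> bead_eq_iff[OF q, of i a] by simp
  qed
  moreover have "bead p c < bead q a"
    using size \<open>t * n \<ge> 1\<close> unfolding of_nat_mult[symmetric] by linarith
  ultimately have "bead_move n (beads N p) (beads N q) (bead p c) (bead q a)"
    using size \<open>c < N\<close> beads_ribbon[OF p rib \<open>c < N\<close>] by (auto simp: bead_move_def beads_def)
  then show ?thesis by (rule that)
qed

section \<open>From a bead move to a border strip\<close>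

text \<open>Every box is joined to the last box of the top row: go right along a row, then up
  through the shared column.\<close>

lemma ribbon_rows_border_strip:
  assumes p: "is_partition p" and q: "is_partition q" and rib: "ribbon_rows p q a c"
  shows "border_strip (card (skew q p)) (skew q p)"
proof -
  define S where "S = skew q p"
  define E where "E = {(x, y). x \<in> S \<and> y \<in> S \<and> adjacent x y}"
  have rows: "a \<le> i \<and> i \<le> c" if "(i, j) \<in> S" for i j
    using that rib by (force simp: S_def skew_eq ribbon_rows_def not_less[symmetric])
  have row: "((i, m), (i, q i - 1)) \<in> E\<^sup>*" if "(i, m) \<in> S" for i m
  proof -
    have "m \<le> q i - 1" using that by (auto simp: S_def skew_eq)
    then show ?thesis using that
    proof (induction rule: inc_induct)
      case (step m)
      then have "((i, m), (i, Suc m)) \<in> E" by (auto simp: E_def S_def skew_eq adjacent_def)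
      moreover have "((i, Suc m), (i, q i - 1)) \<in> E\<^sup>*"
        using step by (auto simp: S_def skew_eq)
      ultimately show ?case by (rule converse_rtrancl_into_rtrancl)
    qed simp
  qed
  have top: "((i, q i - 1), (a, q a - 1)) \<in> E\<^sup>*" if "a \<le> i" "i \<le> c" for i
    using that
  proof (induction rule: dec_induct)
    case (step i)
    have less: "p i < q i" "p (Suc i) < q (Suc i)"
      using ribbon_rows_less[OF q rib] step by auto
    have "q (Suc i) = Suc (p i)" using step rib by (auto simp: ribbon_rows_def)
    \<comment> \<open>The last box of row \<open>Suc i\<close> lies directly below the first new box
      of row \<open>i\<close>.\<close>
    then have "((Suc i, q (Suc i) - 1), (i, p i)) \<in> E"
      using less partition_le[OF p, of i "Suc i"] by (auto simp: E_def S_def skew_eq adjacent_def)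
    moreover have "((i, p i), (i, q i - 1)) \<in> E\<^sup>*"
      using less by (intro row) (auto simp: S_def skew_eq)
    ultimately show ?case using step by (meson Suc_leD converse_rtrancl_into_rtrancl rtrancl_trans)
  qed simp
  have to_top: "(b, (a, q a - 1)) \<in> E\<^sup>*" if "b \<in> S" for b
    using that row rows top by (cases b) (meson rtrancl_trans)
  have "sym E" by (auto simp: E_def sym_def adjacent_def)
  then have "connected_boxes S"
    unfolding connected_boxes_def E_def[symmetric]
    by (meson to_top rtrancl_trans sym_rtrancl symD)
  moreover have "\<not> {(i, j), (i, Suc j), (Suc i, j), (Suc i, Suc j)} \<subseteq> S" for i j
  proof
    assume sq: "{(i, j), (i, Suc j), (Suc i, j), (Suc i, Suc j)} \<subseteq> S"
    then have "q (Suc i) = Suc (p i)"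
      using rows[of i j] rows[of "Suc i" j] rib by (auto simp: ribbon_rows_def)
    then show False using sq by (auto simp: S_def skew_eq)
  qed
  ultimately show ?thesis
    using finite_skew[OF q] by (auto simp: border_strip_def S_def)
qed

text \<open>The row \<open>a\<close> is exported along with the strip because it is the strip's top
  row, where its starting box lies.\<close>

lemma bead_move_border_strip:
  assumes p: "is_partition p" and N: "\<And>i. i \<ge> N \<Longrightarrow> p i = 0"
    and move: "bead_move n (beads N p) T x w"
  obtains q a t where "is_partition q" "\<And>i. i \<ge> N \<Longrightarrow> q i = 0" "beads N q = T" "p \<le> q"
    "t \<ge> 1" "border_strip (t * n) (skew q p)" "a < N" "bead q a = w" "p a < q a"
proof -
  obtain c where c: "c < N" "x = bead p c" using move by (auto simp: bead_move_def beads_def)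
  have xw: "bead p c < w" using move c by (simp add: bead_move_def)
  \<comment> \<open>The row that the moved bead occupies once the beads are put back in decreasing
    order.\<close>
  define a where "a = (LEAST i. bead p i < w)"
  have aw: "bead p a < w" and "a \<le> c" using xw by (auto simp: a_def intro: LeastI Least_le)
  have above: "w < bead p i" if "i < a" for i
  proof -
    have "\<not> bead p i < w" using that not_less_Least by (auto simp: a_def)
    moreover have "bead p i \<noteq> w"
      using move that \<open>a \<le> c\<close> c by (auto simp: bead_move_def beads_def)
    ultimately show ?thesis by simp
  qed
  \<comment> \<open>Row \<open>a\<close> gets the length whose bead is \<open>w\<close>, and each
    later row up to \<open>c\<close> takes over the bead of the row above. The \<open>nat\<close>
    truncates nothing, as \<open>w + int a > int (p a)\<close>.\<close>
  define q where "q = (\<lambda>i. if i < a \<or> c < i then p i else if i = a then nat (w + int a)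
    else Suc (p (i - 1)))"
  have qa: "int (q a) = w + int a" using aw \<open>a \<le> c\<close> by (simp add: q_def bead_def)
  have rib: "ribbon_rows p q a c"
  proof -
    have "p c < q c"
    proof (cases "a = c")
      case True
      then show ?thesis using qa aw by (simp add: bead_def)
    next
      case False
      then show ?thesis
        using \<open>a \<le> c\<close> partition_le[OF p, of "c - 1" c] by (auto simp: q_def)
    qed
    then show ?thesis using \<open>a \<le> c\<close> by (auto simp: ribbon_rows_def q_def)
  qed
  have suc: "q (Suc i) \<le> q i" for i
  proof -
    consider "Suc i < a \<or> c < i" | "Suc i = a" | "i = a" "i < c" | "i = c" | "a < i" "i < c"
      using \<open>a \<le> c\<close> by linarith
    then show ?thesis
    proof cases
      case 1
      then show ?thesis using partition_le[OF p, of i "Suc i"] \<open>a \<le> c\<close> by (auto simp: q_def)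
    next
      case 2
      then have "q i = p i" by (simp add: q_def)
      \<comment> \<open>Strictness in \<open>above\<close>, due to \<open>w\<close> being a free
        place, absorbs the difference of one between the row indices.\<close>
      then show ?thesis using 2 above[of i] qa by (simp add: bead_def)
    next
      case 3
      then have "q (Suc i) = Suc (p a)" by (simp add: q_def)
      then show ?thesis using 3 qa aw by (simp add: bead_def)
    next
      case 4
      then have "q (Suc i) = p (Suc i)" by (simp add: q_def)
      then show ?thesis
        using 4 rib partition_le[OF p, of i "Suc i"] by (simp add: ribbon_rows_def)
    next
      case 5
      then show ?thesis using partition_le[OF p, of "i - 1" i] by (simp add: q_def)
    qed
  qed
  have qN: "q i = 0" if "i \<ge> N" for i using that N c \<open>a \<le> c\<close> by (simp add: q_def)
  have q: "is_partition q"
  proof -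
    have "antimono q" using suc by (simp add: antimono_iff_le_Suc)
    moreover have "{i. q i \<noteq> 0} \<subseteq> {..<N}" using qN by (force simp: not_less[symmetric])
    ultimately show ?thesis by (auto simp: is_partition_def intro: finite_subset)
  qed
  have "p \<le> q"
  proof (rule le_funI)
    fix i
    show "p i \<le> q i"
      using ribbon_rows_less[OF q rib, of i] rib
      by (cases "i < a \<or> c < i") (auto simp: ribbon_rows_def)
  qed
  have w: "bead q a = w" using qa by (simp add: bead_def)
  have "beads N q = T"
    using beads_ribbon[OF p rib c(1)] move c w by (simp add: bead_move_def)
  \<comment> \<open>The quotient \<open>s\<close> is positive because the bead moves right, so
    \<open>nat s\<close> serves as the weight.\<close>
  obtain s where s: "w - x = int n * s" using move by (auto simp: bead_move_def)
  then have "int n * s > 0" using c xw by simp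
  then have "s > 0" by (simp add: zero_less_mult_iff)
  then have "int (card (skew q p)) = int (nat s * n)"
    using card_ribbon[OF q rib] w c s by (simp add: mult.commute)
  then have "border_strip (nat s * n) (skew q p)"
    using ribbon_rows_border_strip[OF p q rib] by (simp only: of_nat_eq_iff)
  moreover have "p a < q a" using ribbon_rows_less[OF q rib order_refl \<open>a \<le> c\<close>] .
  ultimately show ?thesis
    using that[of q "nat s" a] q qN \<open>beads N q = T\<close> \<open>p \<le> q\<close> \<open>s > 0\<close> \<open>a \<le> c\<close> c w by auto
qed

section \<open>Existence of horizontal chains\<close>

lemma strip_chain_prefix:
  assumes "strip_chain n \<tau> lam mu \<alpha>" and "j \<le> length \<tau>"
  shows "mu \<le> \<alpha> ! j" and "card (skew (\<alpha> ! j) mu) = (\<Sum>i<j. \<tau> ! i) * n"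
proof -
  have "mu \<le> \<alpha> ! j \<and> card (skew (\<alpha> ! j) mu) = (\<Sum>i<j. \<tau> ! i) * n"
    using assms(2)
  proof (induction j)
    case 0
    then show ?case using assms(1) by (simp add: strip_chain_def skew_def)
  next
    case (Suc j)
    let ?p = "\<alpha> ! j" and ?q = "\<alpha> ! Suc j"
    have IH: "mu \<le> ?p" "card (skew ?p mu) = (\<Sum>i<j. \<tau> ! i) * n" using Suc by auto
    have *: "is_partition ?p" "is_partition ?q" "?p \<le> ?q" "card (skew ?q ?p) = \<tau> ! j * n"
      using assms(1) Suc.prems by (auto simp: strip_chain_def border_strip_def)
    have "skew ?q mu = skew ?p mu \<union> skew ?q ?p"
      using IH(1) *(3) by (auto simp: skew_eq le_fun_def) (meson le_trans less_le_trans not_le)+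
    moreover have "skew ?p mu \<inter> skew ?q ?p = {}" by (auto simp: skew_eq)
    ultimately have "card (skew ?q mu) = card (skew ?p mu) + card (skew ?q ?p)"
      using *(1,2) by (simp add: card_Un_disjoint finite_skew)
    then show ?case using IH * by (auto simp: algebra_simps)
  qed
  then show "mu \<le> \<alpha> ! j" and "card (skew (\<alpha> ! j) mu) = (\<Sum>i<j. \<tau> ! i) * n" by auto
qed

lemma strip_chain_sorted_moves:
  assumes "strip_chain n \<tau> lam mu \<alpha>" and "n \<ge> 1" and N: "\<And>i. i \<ge> N \<Longrightarrow> lam i = 0"
  shows "sorted_moves n (beads N mu) (beads N lam)"
proof -
  have le: "\<alpha> ! j \<le> lam" if "j \<le> length \<tau>" for j
    using that
  proof (induction rule: inc_induct)
    case base
    then show ?case using assms(1) by (simp add: strip_chain_def)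
  next
    case (step j)
    then have "\<alpha> ! j \<le> \<alpha> ! Suc j" using assms(1) by (simp add: strip_chain_def)
    then show ?case using step by (meson order_trans)
  qed
  have "sorted_moves n (beads N mu) (beads N (\<alpha> ! j))" if "j \<le> length \<tau>" for j
    using that
  proof (induction j)
    case 0
    then show ?case using assms(1) by (simp add: strip_chain_def sorted_moves.refl)
  next
    case (Suc j)
    let ?p = "\<alpha> ! j" and ?q = "\<alpha> ! Suc j"
    have *: "is_partition ?p" "is_partition ?q" "?p \<le> ?q" "\<tau> ! j \<ge> 1"
        "border_strip (\<tau> ! j * n) (skew ?q ?p)"
      using assms(1) Suc.prems by (auto simp: strip_chain_def)
    have "?q i = 0" if "i \<ge> N" for i
      using le[OF Suc.prems] N[OF that] by (metis le_fun_def le_zero_eq)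
    then obtain x w where "bead_move n (beads N ?p) (beads N ?q) x w"
      using border_strip_bead_move[OF *(1-3,5)] *(4) \<open>n \<ge> 1\<close> by (metis mult_le_mono nat_mult_1)
    then show ?case using Suc sorted_moves_move by simp
  qed
  then show ?thesis using assms(1) by (auto simp: strip_chain_def)
qed

text \<open>By \<open>above\<close>, nothing of \<open>lam/mu\<close> lies above row
  \<open>a\<close>, so the last box of row \<open>a\<close> is northeasternmost in all of
  \<open>lam/mu\<close>. It is therefore the new starting box, a column top, and northeast of all
  earlier starting boxes.\<close>

lemma horizontal_chain_snoc:
  assumes chain: "strip_chain n \<tau> lam' mu \<alpha>" and hor: "horizontal_chain lam' mu \<alpha>"
    and lam: "is_partition lam" and "lam' \<le> lam"
    and strip: "border_strip (t * n) (skew lam lam')" and "t \<ge> 1"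
    and "lam' a < lam a" and above: "\<And>i. i < a \<Longrightarrow> lam i \<le> mu i"
  shows "strip_chain n (\<tau> @ [t]) lam mu (\<alpha> @ [lam])" and "horizontal_chain lam mu (\<alpha> @ [lam])"
proof -
  let ?l = "length \<tau>"
  have len: "length \<alpha> = Suc ?l" and last: "\<alpha> ! ?l = lam'"
    using chain by (auto simp: strip_chain_def)
  have "mu \<le> lam'" using strip_chain_prefix(1)[OF chain] last by force
  have nth: "(\<alpha> @ [lam]) ! i = \<alpha> ! i" if "i \<le> ?l" for i using that len by (simp add: nth_append)
  have nth': "(\<alpha> @ [lam]) ! Suc ?l = lam" using len by (simp add: nth_append)
  show "strip_chain n (\<tau> @ [t]) lam mu (\<alpha> @ [lam])"
    using chain lam strip \<open>lam' \<le> lam\<close> \<open>t \<ge> 1\<close> len last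
    unfolding strip_chain_def
    by (auto simp: nth_append less_Suc_eq le_Suc_eq)
  define s where "s = (a, lam a - 1)"
  have rows: "a \<le> i" if "(i, j) \<in> skew lam mu" for i j
    using that above by (force simp: skew_eq not_less[symmetric])
  have s: "s \<in> skew lam lam'" using \<open>lam' a < lam a\<close> by (auto simp: s_def skew_eq)
  have sub: "skew lam lam' \<subseteq> skew lam mu" "skew lam' mu \<subseteq> skew lam mu"
    using \<open>mu \<le> lam'\<close> \<open>lam' \<le> lam\<close>
    by (auto simp: skew_eq le_fun_def intro: le_trans less_le_trans)
  have ne: "fst s \<le> fst c \<and> snd c \<le> snd s" if "c \<in> skew lam mu" for c
  proof -
    obtain i j where c: "c = (i, j)" by (cases c)
    then have "a \<le> i" "j < lam i" using that rows by (auto simp: skew_eq)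
    then show ?thesis using partition_le[OF lam, of a i] c by (simp add: s_def)
  qed
  have start: "starting_box (skew lam lam') = s"
    unfolding starting_box_def
  proof (rule the_equality)
    show "s \<in> skew lam lam' \<and> (\<forall>c\<in>skew lam lam'. fst s \<le> fst c \<and> snd c \<le> snd s)"
      using s ne sub by auto
  next
    fix b assume "b \<in> skew lam lam' \<and> (\<forall>c\<in>skew lam lam'. fst b \<le> fst c \<and> snd c \<le> snd b)"
    then show "b = s" using s ne[of b] sub by (auto intro!: prod_eqI antisym)
  qed
  have top: "s \<in> column_tops (skew lam mu)"
    using s sub rows by (auto simp: column_tops_def s_def)
  have tops: "b \<in> column_tops (skew lam mu)" if "b \<in> column_tops (skew lam' mu)" for b
  proof -
    obtain i j where b: "b = (i, j)" by (cases b)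
    have ij: "(i, j) \<in> skew lam' mu" and min: "\<And>i'. (i', j) \<in> skew lam' mu \<Longrightarrow> i \<le> i'"
      using that b by (auto simp: column_tops_def)
    \<comment> \<open>Boxes above a box of \<open>lam'\<close> lie in \<open>lam'\<close> already,
      so the new strip creates no higher top in an old column.\<close>
    have "i \<le> i'" if i': "(i', j) \<in> skew lam mu" for i'
    proof (rule ccontr)
      assume "\<not> i \<le> i'"
      moreover have "is_partition lam'" using chain last by (auto simp: strip_chain_def)
      ultimately have "lam' i \<le> lam' i'" using partition_le[of lam' i' i] by simp
      then have "(i', j) \<in> skew lam' mu" using ij i' by (auto simp: skew_eq)
      then show False using min \<open>\<not> i \<le> i'\<close> by blast
    qed
    then show ?thesis using ij sub b by (auto simp: column_tops_def)
  qed
  have sw: "southwest b s" if b: "b \<in> column_tops (skew lam' mu)" for b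
  proof -
    have in': "b \<in> skew lam' mu" using b by (auto simp: column_tops_def)
    then have "b \<noteq> s" using s by (auto simp: skew_def)
    moreover have le: "fst s \<le> fst b \<and> snd b \<le> snd s" using in' sub ne by blast
    \<comment> \<open>Strictness of columns: in a common column the top \<open>b\<close> would
      coincide with \<open>s\<close>, but \<open>s\<close> lies outside \<open>lam'\<close>.\<close>
    moreover have "fst b \<le> fst s" if "snd b = snd s"
      using tops[OF b] that s sub by (cases b; cases s) (auto simp: column_tops_def)
    ultimately show ?thesis
      unfolding southwest_def by (metis antisym le_neq_implies_less prod_eqI)
  qed
  have start_old: "chain_start (\<alpha> @ [lam]) i = chain_start \<alpha> i" if "i < ?l" for i
    using that nth by (simp add: chain_start_def)
  have start_new: "chain_start (\<alpha> @ [lam]) ?l = s"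
    using nth nth' last start by (simp add: chain_start_def)
  have old: "chain_start \<alpha> i \<in> column_tops (skew lam' mu)" if "i < ?l" for i
    using hor that len by (simp add: horizontal_chain_def chain_length_def)
  have old_sw: "southwest (chain_start \<alpha> i) (chain_start \<alpha> j)" if "i < j" "j < ?l" for i j
    using hor that len by (simp add: horizontal_chain_def chain_length_def)
  show "horizontal_chain lam mu (\<alpha> @ [lam])"
    unfolding horizontal_chain_def chain_length_def
    using start_old start_new old_sw top tops[OF old] sw[OF old] len by (auto simp: less_Suc_eq)
qed

lemma sorted_moves_horizontal_chain:
  assumes "sorted_moves n (beads N mu) T" and mu: "is_partition mu"
    and N: "\<And>i. i \<ge> N \<Longrightarrow> mu i = 0"
  obtains lam \<tau> \<alpha> where "is_partition lam" "\<And>i. i \<ge> N \<Longrightarrow> lam i = 0" "beads N lam = T"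
    "strip_chain n \<tau> lam mu \<alpha>" "horizontal_chain lam mu \<alpha>"
proof -
  have "\<exists>lam \<tau> \<alpha>. is_partition lam \<and> (\<forall>i\<ge>N. lam i = 0) \<and> beads N lam = T \<and>
    strip_chain n \<tau> lam mu \<alpha> \<and> horizontal_chain lam mu \<alpha>"
    using assms(1)
  proof (induction rule: sorted_moves.induct)
    case refl
    have "strip_chain n [] mu mu [mu]" "horizontal_chain mu mu [mu]"
      using mu by (auto simp: strip_chain_def horizontal_chain_def chain_length_def)
    then show ?case using mu N by blast
  next
    case (step T U x w)
    then obtain p \<tau> \<alpha> where p: "is_partition p" "\<And>i. i \<ge> N \<Longrightarrow> p i = 0" "beads N p = T"
      and chain: "strip_chain n \<tau> p mu \<alpha>" and hor: "horizontal_chain p mu \<alpha>" by auto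
    obtain q a t where q: "is_partition q" "\<And>i. i \<ge> N \<Longrightarrow> q i = 0" "beads N q = U" "p \<le> q"
        "t \<ge> 1" "border_strip (t * n) (skew q p)" "a < N" "bead q a = w" "p a < q a"
      using bead_move_border_strip[OF p(1,2)] step.hyps(2) p(3) by metis
    have "mu \<le> p" using strip_chain_prefix(1)[OF chain] chain by (auto simp: strip_chain_def)
    then have "mu \<le> q" using q(4) by simp
    \<comment> \<open>The side condition on sorted moves enters here: it keeps the rows above the
      new strip free of boxes of \<open>q/mu\<close>.\<close>
    have "q i \<le> mu i" if "i < a" for i
      using bead_le_of_beads_above[OF q(1) mu \<open>mu \<le> q\<close> _ _ that] step.hyps(3) q(3,7,8)
      by (auto simp: bead_def)
    then show ?case
      using horizontal_chain_snoc[OF chain hor q(1,4,6,5,9)] q(1,2,3) by blast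
  qed
  then show ?thesis using that by blast
qed

text \<open>Any chain is read as bead moves, sorted, and rebuilt as strips; the end result has the
  beads of \<open>lam\<close> and so equals \<open>lam\<close>. Merging may shorten the chain, which
  is harmless for existence.\<close>

lemma horizontal_strip_chains_nonempty:
  assumes "n \<ge> 1" and lam: "is_partition lam" and mu: "is_partition mu" and "mu \<le> lam"
    and "strip_chains n lam mu \<noteq> {}"
  shows "horizontal_strip_chains n lam mu \<noteq> {}"
proof -
  obtain \<tau> \<alpha> where chain: "strip_chain n \<tau> lam mu \<alpha>" using assms by (auto simp: strip_chains_def)
  have "finite {i. lam i \<noteq> 0}" using lam by (simp add: is_partition_def)
  then obtain N where "\<forall>i\<in>{i. lam i \<noteq> 0}. i < N" using finite_nat_set_iff_bounded by metis
  then have N: "lam i = 0" if "i \<ge> N" for i using that by (force simp: not_less[symmetric])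
  then have N': "mu i = 0" if "i \<ge> N" for i
    using that \<open>mu \<le> lam\<close> by (metis le_fun_def le_zero_eq)
  obtain q \<sigma> \<beta> where q: "is_partition q" "\<And>i. i \<ge> N \<Longrightarrow> q i = 0" "beads N q = beads N lam"
      "strip_chain n \<sigma> q mu \<beta>" "horizontal_chain q mu \<beta>"
    using sorted_moves_horizontal_chain[OF
        strip_chain_sorted_moves[OF chain \<open>n \<ge> 1\<close> N] mu N'] by blast
  have "q = lam" using beads_inject[OF q(1) lam q(2) N q(3)] .
  then show ?thesis using q by (auto simp: horizontal_strip_chains_def strip_chains_def)
qed

section \<open>Lengths of chains\<close>

lemma sum_nth_ge_length:
  fixes \<tau> :: "nat list"
  assumes "\<And>i. i < length \<tau> \<Longrightarrow> \<tau> ! i \<ge> 1"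
  shows "length \<tau> \<le> (\<Sum>i<length \<tau>. \<tau> ! i)"
    and "(\<Sum>i<length \<tau>. \<tau> ! i) = length \<tau> \<Longrightarrow> \<tau> = replicate (length \<tau>) 1"
proof -
  show "length \<tau> \<le> (\<Sum>i<length \<tau>. \<tau> ! i)"
    using sum_bounded_below[of "{..<length \<tau>}" 1 "\<lambda>i. \<tau> ! i"] assms by simp
  assume eq: "(\<Sum>i<length \<tau>. \<tau> ! i) = length \<tau>"
  have "1 = \<tau> ! i" if "i < length \<tau>" for i
    using sum_mono_inv[of "\<lambda>_. 1" "{..<length \<tau>}" "\<lambda>i. \<tau> ! i" i] assms eq that by simp
  then show "\<tau> = replicate (length \<tau>) 1" by (intro nth_equalityI) auto
qed

text \<open>Counting boxes, the weights sum to \<open>k\<close>; each is at least 1, so there are at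
  most \<open>k\<close> of them, and exactly \<open>k\<close> only if all are 1.\<close>

lemma strip_chain_length:
  assumes chain: "strip_chain n \<tau> lam mu \<alpha>" and "n \<ge> 1" and "card (skew lam mu) = k * n"
  shows "chain_length \<alpha> = length \<tau>" and "chain_length \<alpha> \<le> k"
    and "chain_length \<alpha> = k \<Longrightarrow> \<tau> = replicate k 1"
proof -
  show len: "chain_length \<alpha> = length \<tau>" using chain by (simp add: strip_chain_def chain_length_def)
  have "(\<Sum>i<length \<tau>. \<tau> ! i) * n = k * n"
    using strip_chain_prefix(2)[OF chain order_refl] chain assms(3)
    by (simp only: strip_chain_def)
  then have "(\<Sum>i<length \<tau>. \<tau> ! i) = k" using \<open>n \<ge> 1\<close> by simp
  moreover have "\<And>i. i < length \<tau> \<Longrightarrow> \<tau> ! i \<ge> 1" using chain by (simp add: strip_chain_def)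
  ultimately show "chain_length \<alpha> \<le> k" and "chain_length \<alpha> = k \<Longrightarrow> \<tau> = replicate k 1"
    using sum_nth_ge_length[of \<tau>] len by auto
qed

theorem proposition2p2:
  fixes n k :: nat and lam mu :: "nat \<Rightarrow> nat"
  assumes "n \<ge> 1" and "k \<ge> 1"
    and "is_partition lam" and "is_partition mu" and "mu \<le> lam"
    and "strip_chains n lam mu \<noteq> {}"
    and "card (skew lam mu) = k * n"
  shows "horizontal_border_strip n k lam mu \<longleftrightarrow> max_horizontal_length n lam mu = k"
proof -
  define L where "L = chain_length ` horizontal_strip_chains n lam mu"
  have "L \<noteq> {}"
    using horizontal_strip_chains_nonempty[OF assms(1,3,4,5,6)] by (simp add: L_def)
  have bound: "l \<le> k" if "l \<in> L" for l
    using that strip_chain_length(2)[OF _ assms(1,7)]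
    by (auto simp: L_def horizontal_strip_chains_def strip_chains_def)
  then have "finite L" using finite_nat_set_iff_bounded_le by blast
  have "horizontal_border_strip n k lam mu \<longleftrightarrow> k \<in> L"
  proof
    assume "horizontal_border_strip n k lam mu"
    then obtain \<alpha> where chain: "strip_chain n (replicate k 1) lam mu \<alpha>"
      and hor: "horizontal_chain lam mu \<alpha>" by (auto simp: horizontal_border_strip_def)
    then have "\<alpha> \<in> horizontal_strip_chains n lam mu"
      by (auto simp: horizontal_strip_chains_def strip_chains_def)
    moreover have "chain_length \<alpha> = k" using strip_chain_length(1)[OF chain assms(1,7)] by simp
    ultimately show "k \<in> L" by (auto simp: L_def)
  next
    assume "k \<in> L"
    then obtain \<alpha> \<tau> where "strip_chain n \<tau> lam mu \<alpha>" "horizontal_chain lam mu \<alpha>"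
      "chain_length \<alpha> = k"
      by (auto simp: L_def horizontal_strip_chains_def strip_chains_def)
    then show "horizontal_border_strip n k lam mu"
      using strip_chain_length(3)[OF _ assms(1,7)] by (auto simp: horizontal_border_strip_def)
  qed
  \<comment> \<open>Since \<open>L\<close> is nonempty, its maximum is attained; since
    \<open>k\<close> bounds \<open>L\<close>, membership of \<open>k\<close> makes it the
    maximum.\<close>
  also have "\<dots> \<longleftrightarrow> Max L = k"
    using \<open>finite L\<close> \<open>L \<noteq> {}\<close> bound Max_in Max_ge antisym by metis
  finally show ?thesis by (simp add: max_horizontal_length_def L_def)
qed

end
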